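(* Let $A$ be a Banach algebra and let $e\in A$ be an element of the closed unit ball of $A$. Then the following hold: (1) If $A$ is approximately biprojective and $A_e$ is unital, then $A_e$ is approximately biprojective. (2) If $A_e$ is unital and approximately biprojective, then $A$ is approximately biprojective.
   Context: For a Banach algebra $A$ and an element $e$ of the closed unit ball $\overline{B^0_1}$ of $A$ (so $\|e\|\le 1$), $A_e$ denotes the Banach algebra whose underlying Banach space is $A$ and whose product is $a\ast b=aeb$. For a Banach algebra $A$, the projective tensor product $A\otimes_p A$ is a Banach $A$-bimodule via $a\cdot(b\otimes c)=ab\otimes c$ and $(b\otimes c)\cdot a=b\otimes ca$, and $\pi_A:A\otimes_pA\to A$ is the bounded linear map determined by $\pi_A(a\otimes b)=ab$ (for $A_e$ all of these are formed with the product $\ast$). A Banach algebra $A$ is called approximately biprojective if there exists a net $(\rho_\alpha)$ of bounded linear maps from $A$ into $A\otimes_pA$ such that, for all $a,b\in A$, in norm: (i) $a\cdot\rho_\alpha(b)-\rho_\alpha(ab)\to0$; (ii) $\rho_\alpha(ba)-\rho_\alpha(b)\cdot a\to0$; (iii) $\pi_A\circ\rho_\alpha(a)-a\to0$. *)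

theory Defs
  imports "HOL-Analysis.Analysis" "HOL-Library.Poly_Mapping"
begin

section \<open>Complex Banach spaces\<close>

class scaleC =
  fixes scaleC :: "complex \<Rightarrow> 'a \<Rightarrow> 'a"  (infixr \<open>*\<^sub>C\<close> 75)

class complex_vector = real_vector + scaleC +
  assumes scaleC_add_right: "c *\<^sub>C (x + y) = c *\<^sub>C x + c *\<^sub>C y"
    and scaleC_add_left: "(c + d) *\<^sub>C x = c *\<^sub>C x + d *\<^sub>C x"
    and scaleC_scaleC: "c *\<^sub>C d *\<^sub>C x = (c * d) *\<^sub>C x"
    and scaleC_of_real: "of_real r *\<^sub>C x = r *\<^sub>R x"

class complex_normed_vector = complex_vector + real_normed_vector +
  assumes norm_scaleC: "norm (c *\<^sub>C x) = norm c * norm x"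

class complex_banach = complex_normed_vector + banach

instantiation complex :: complex_banach
begin
definition scaleC_complex :: "complex \<Rightarrow> complex \<Rightarrow> complex"
  where "scaleC_complex c x = c * x"
instance
  by standard (simp_all add: scaleC_complex_def algebra_simps norm_mult scaleR_conv_of_real)
end

lemma scaleC_one: "1 *\<^sub>C (x::'a::complex_vector) = x"
  using scaleC_of_real[of 1 x] by simp

interpretation complex_vector: vector_space "scaleC :: complex \<Rightarrow> 'a \<Rightarrow> 'a::complex_vector"
  by standard (simp_all add: scaleC_add_right scaleC_add_left scaleC_scaleC scaleC_one)

definition clinear :: "('a::complex_vector \<Rightarrow> 'b::complex_vector) \<Rightarrow> bool"
  where "clinear f \<longleftrightarrow> (\<forall>x y. f (x + y) = f x + f y) \<and> (\<forall>c x. f (c *\<^sub>C x) = c *\<^sub>C f x)"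

definition bounded_clinear :: "('a::complex_normed_vector \<Rightarrow> 'b::complex_normed_vector) \<Rightarrow> bool"
  where "bounded_clinear f \<longleftrightarrow> clinear f \<and> (\<exists>K. \<forall>x. norm (f x) \<le> norm x * K)"

definition bounded_cbilinear ::
    "('a::complex_normed_vector \<Rightarrow> 'b::complex_normed_vector \<Rightarrow> 'c::complex_normed_vector) \<Rightarrow> bool"
  where "bounded_cbilinear B \<longleftrightarrow> (\<forall>y. clinear (\<lambda>x. B x y)) \<and> (\<forall>x. clinear (B x)) \<and>
    (\<exists>K. \<forall>x y. norm (B x y) \<le> norm x * norm y * K)"

lemma clinearD:
  assumes "clinear f"
  shows "f (x + y) = f x + f y" "f (c *\<^sub>C x) = c *\<^sub>C f x" "f 0 = 0" "f (- x) = - f x"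
    "f (x - y) = f x - f y"
proof -
  show a: "f (x + y) = f x + f y" for x y using assms by (auto simp: clinear_def)
  show b: "f (c *\<^sub>C x) = c *\<^sub>C f x" for c x using assms by (auto simp: clinear_def)
  show "f 0 = 0" using a[of 0 0] by simp
  show c: "f (- x) = - f x" for x
    using a[of x "-x"] \<open>f 0 = 0\<close> by (simp add: eq_neg_iff_add_eq_0 add.commute)
  show "f (x - y) = f x - f y" using a[of x "-y"] c[of y] by simp
qed

lemma clinear_sum: "clinear f \<Longrightarrow> f (sum g A) = (\<Sum>x\<in>A. f (g x))"
  by (induct A rule: infinite_finite_induct) (simp_all add: clinearD)

lemma clinear_scaleR: "clinear f \<Longrightarrow> f (r *\<^sub>R x) = r *\<^sub>R f x"
  by (simp add: clinearD flip: scaleC_of_real)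

lemma bounded_clinear_bounded_linear: "bounded_clinear f \<Longrightarrow> bounded_linear f"
  unfolding bounded_clinear_def
  by (auto intro!: bounded_linear_intro simp: clinearD clinear_scaleR)

lemma bounded_linear_bounded_clinear:
  "bounded_linear f \<Longrightarrow> (\<And>c x. f (c *\<^sub>C x) = c *\<^sub>C f x) \<Longrightarrow> bounded_clinear f"
  unfolding bounded_clinear_def clinear_def
  by (auto simp: linear_add bounded_linear.linear dest: bounded_linear.bounded)


section \<open>The algebraic tensor product\<close>

text \<open>The free complex vector space on \<open>X \<times> Y\<close> modulo the bilinearity relations.\<close>

definition free_scale :: "complex \<Rightarrow> ('k \<Rightarrow>\<^sub>0 complex) \<Rightarrow> 'k \<Rightarrow>\<^sub>0 complex"
  where "free_scale c = Poly_Mapping.map (\<lambda>z. c * z)"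

lemma lookup_free_scale [simp]: "Poly_Mapping.lookup (free_scale c f) k = c * Poly_Mapping.lookup f k"
  by (simp add: free_scale_def Poly_Mapping.map.rep_eq when_def)

interpretation free: vector_space free_scale
  by standard (auto intro!: poly_mapping_eqI simp: lookup_add algebra_simps)

definition bilinear_relations ::
    "(('a::complex_vector \<times> 'b::complex_vector) \<Rightarrow>\<^sub>0 complex) set"
  where "bilinear_relations =
    {Poly_Mapping.single (x + x', y) 1 - Poly_Mapping.single (x, y) 1 - Poly_Mapping.single (x', y) 1 | x x' y. True} \<union>
    {Poly_Mapping.single (x, y + y') 1 - Poly_Mapping.single (x, y) 1 - Poly_Mapping.single (x, y') 1 | x y y'. True} \<union>
    {Poly_Mapping.single (c *\<^sub>C x, y) 1 - free_scale c (Poly_Mapping.single (x, y) 1) | c x y. True} \<union>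
    {Poly_Mapping.single (x, c *\<^sub>C y) 1 - free_scale c (Poly_Mapping.single (x, y) 1) | c x y. True}"

definition tensor_eq ::
    "(('a::complex_vector \<times> 'b::complex_vector) \<Rightarrow>\<^sub>0 complex) \<Rightarrow> (('a \<times> 'b) \<Rightarrow>\<^sub>0 complex) \<Rightarrow> bool"
  where "tensor_eq f g \<longleftrightarrow> f - g \<in> free.span bilinear_relations"

quotient_type (overloaded) ('a, 'b) atensor =
  "('a::complex_vector \<times> 'b::complex_vector) \<Rightarrow>\<^sub>0 complex" / tensor_eq
proof (rule equivpI)
  show "reflp (tensor_eq :: (('a \<times> 'b) \<Rightarrow>\<^sub>0 complex) \<Rightarrow> _)"
    by (auto simp: reflp_def tensor_eq_def free.span_zero)
  show "symp (tensor_eq :: (('a \<times> 'b) \<Rightarrow>\<^sub>0 complex) \<Rightarrow> _)"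
    unfolding symp_def tensor_eq_def by (metis free.span_neg minus_diff_eq)
  show "transp (tensor_eq :: (('a \<times> 'b) \<Rightarrow>\<^sub>0 complex) \<Rightarrow> _)"
  proof (rule transpI)
    fix f g h :: "('a \<times> 'b) \<Rightarrow>\<^sub>0 complex"
    assume "tensor_eq f g" "tensor_eq g h"
    then have "(f - g) + (g - h) \<in> free.span bilinear_relations"
      unfolding tensor_eq_def by (rule free.span_add)
    then show "tensor_eq f h" by (simp add: tensor_eq_def)
  qed
qed

instantiation atensor :: (complex_vector, complex_vector) complex_vector
begin

lift_definition zero_atensor :: "('a, 'b) atensor" is 0 .

lift_definition plus_atensor :: "('a, 'b) atensor \<Rightarrow> ('a, 'b) atensor \<Rightarrow> ('a, 'b) atensor" is "(+)"
  unfolding tensor_eq_def by (metis free.span_add add_diff_add)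

lift_definition uminus_atensor :: "('a, 'b) atensor \<Rightarrow> ('a, 'b) atensor" is uminus
  unfolding tensor_eq_def by (metis free.span_neg minus_diff_minus)

lift_definition minus_atensor :: "('a, 'b) atensor \<Rightarrow> ('a, 'b) atensor \<Rightarrow> ('a, 'b) atensor" is "(-)"
proof -
  fix f f' g g' :: "('a \<times> 'b) \<Rightarrow>\<^sub>0 complex"
  assume "tensor_eq f f'" "tensor_eq g g'"
  then have "(f - f') - (g - g') \<in> free.span bilinear_relations"
    unfolding tensor_eq_def by (rule free.span_diff)
  then show "tensor_eq (f - g) (f' - g')" by (simp add: tensor_eq_def algebra_simps)
qed

lift_definition scaleC_atensor :: "complex \<Rightarrow> ('a, 'b) atensor \<Rightarrow> ('a, 'b) atensor" is free_scale
  unfolding tensor_eq_def by (metis free.span_scale free.scale_right_diff_distrib)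

definition scaleR_atensor :: "real \<Rightarrow> ('a, 'b) atensor \<Rightarrow> ('a, 'b) atensor"
  where "scaleR_atensor r u = of_real r *\<^sub>C u"

instance
proof
  fix u v w :: "('a, 'b) atensor" and c d :: complex and r s :: real
  have refl: "tensor_eq f f" for f :: "('a \<times> 'b) \<Rightarrow>\<^sub>0 complex"
    by (simp add: tensor_eq_def free.span_zero)
  show "u + v + w = u + (v + w)" by transfer (simp add: add.assoc refl)
  show "u + v = v + u" by transfer (simp add: add.commute refl)
  show "0 + u = u" by transfer (simp add: refl)
  show "- u + u = 0" by transfer (simp add: refl)
  show "u - v = u + - v" by transfer (simp add: refl)
  show 1: "c *\<^sub>C (u + v) = c *\<^sub>C u + c *\<^sub>C v" for c
    by transfer (simp add: free.scale_right_distrib refl)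
  show 2: "(c + d) *\<^sub>C u = c *\<^sub>C u + d *\<^sub>C u" for c d
    by transfer (simp add: free.scale_left_distrib refl)
  show 3: "c *\<^sub>C d *\<^sub>C u = (c * d) *\<^sub>C u" for c d by transfer (simp add: refl)
  have 4: "1 *\<^sub>C u = u" by transfer (simp add: refl)
  show "of_real r *\<^sub>C u = r *\<^sub>R u" by (simp add: scaleR_atensor_def)
  show "r *\<^sub>R (u + v) = r *\<^sub>R u + r *\<^sub>R v" by (simp add: scaleR_atensor_def 1)
  show "(r + s) *\<^sub>R u = r *\<^sub>R u + s *\<^sub>R u" by (simp add: scaleR_atensor_def 2)
  show "r *\<^sub>R s *\<^sub>R u = (r * s) *\<^sub>R u" by (simp add: scaleR_atensor_def 3)
  show "1 *\<^sub>R u = u" by (simp add: scaleR_atensor_def 4)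
qed

end

lift_definition atens :: "'a::complex_vector \<Rightarrow> 'b::complex_vector \<Rightarrow> ('a, 'b) atensor"
  is "\<lambda>x y. Poly_Mapping.single (x, y) 1" .

lemma atens_add_left: "atens (x + x') y = atens x y + atens x' y"
  by (transfer, unfold tensor_eq_def diff_diff_add [symmetric] bilinear_relations_def,
      rule free.span_base, blast)

lemma atens_add_right: "atens x (y + y') = atens x y + atens x y'"
  by (transfer, unfold tensor_eq_def diff_diff_add [symmetric] bilinear_relations_def,
      rule free.span_base, blast)

lemma atens_scaleC_left: "atens (c *\<^sub>C x) y = c *\<^sub>C atens x y"
  by (transfer, unfold tensor_eq_def bilinear_relations_def, rule free.span_base, blast)

lemma atens_scaleC_right: "atens x (c *\<^sub>C y) = c *\<^sub>C atens x y"
  by (transfer, unfold tensor_eq_def bilinear_relations_def, rule free.span_base, blast)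


lemma clinear_atens: "clinear (\<lambda>x. atens x y)" "clinear (atens x)"
  by (simp_all add: clinear_def atens_add_left atens_add_right atens_scaleC_left atens_scaleC_right)

definition atens_sum :: "('a::complex_vector \<times> 'b::complex_vector) list \<Rightarrow> ('a, 'b) atensor"
  where "atens_sum xs = (\<Sum>(x, y)\<leftarrow>xs. atens x y)"

lemma atens_sum_simps [simp]:
  "atens_sum [] = 0" "atens_sum (p # xs) = atens (fst p) (snd p) + atens_sum xs"
  "atens_sum (xs @ ys) = atens_sum xs + atens_sum ys"
  by (simp_all add: atens_sum_def case_prod_beta)

lemma atens_sum_scaleC: "c *\<^sub>C atens_sum xs = atens_sum (map (\<lambda>(x, y). (c *\<^sub>C x, y)) xs)"
  by (induct xs) (auto simp: scaleC_add_right atens_scaleC_left)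

lemma atensor_plus_abs: "abs_atensor f + abs_atensor g = abs_atensor (f + g)"
  by (rule plus_atensor.abs_eq)

lemma abs_atensor_single: "abs_atensor (Poly_Mapping.single k c) = atens (c *\<^sub>C fst k) (snd k)"
proof -
  have "Poly_Mapping.single k c = free_scale c (Poly_Mapping.single k 1)"
    by (rule poly_mapping_eqI) (simp add: lookup_single when_def)
  then have "abs_atensor (Poly_Mapping.single k c) = c *\<^sub>C abs_atensor (Poly_Mapping.single k 1)"
    by (simp add: scaleC_atensor.abs_eq)
  also have "abs_atensor (Poly_Mapping.single k 1) = atens (fst k) (snd k)"
    by (simp add: atens.abs_eq)
  finally show ?thesis by (simp add: atens_scaleC_left)
qed

lemma atens_sum_exists:
  fixes u :: "('a::complex_vector, 'b::complex_vector) atensor"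
  shows "\<exists>xs. u = atens_sum xs"
proof -
  have *: "\<exists>xs. abs_atensor f = atens_sum xs" if "finite K" "Poly_Mapping.keys f \<subseteq> K"
    for f :: "('a \<times> 'b) \<Rightarrow>\<^sub>0 complex" and K
    using that
  proof (induct K arbitrary: f rule: finite_induct)
    case empty
    then show ?case
      by (intro exI[of _ "[]"]) (simp add: zero_atensor_def)
  next
    case (insert k K)
    let ?g = "f - Poly_Mapping.single k (Poly_Mapping.lookup f k)"
    have "Poly_Mapping.keys ?g \<subseteq> K"
    proof
      fix i assume "i \<in> Poly_Mapping.keys ?g"
      then have i: "Poly_Mapping.lookup ?g i \<noteq> 0" by (simp only: in_keys_iff not_False_eq_True)
      then have "i \<noteq> k" by (auto simp: lookup_minus)
      with i have "Poly_Mapping.lookup f i \<noteq> 0" by (auto simp: lookup_minus lookup_single when_def)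
      then show "i \<in> K" using insert.prems \<open>i \<noteq> k\<close> by (auto simp: in_keys_iff)
    qed
    then obtain xs where "abs_atensor ?g = atens_sum xs" using insert.hyps(3) by blast
    moreover have "abs_atensor f = abs_atensor (Poly_Mapping.single k (Poly_Mapping.lookup f k)) + abs_atensor ?g"
      by (simp add: atensor_plus_abs)
    ultimately have "abs_atensor f = atens_sum ((Poly_Mapping.lookup f k *\<^sub>C fst k, snd k) # xs)"
      by (simp add: abs_atensor_single)
    then show ?case by blast
  qed
  obtain f where "u = abs_atensor f" using Quotient3_abs_rep[OF Quotient3_atensor, of u] by metis
  then show ?thesis using *[of "Poly_Mapping.keys f" f] by simp
qed

lemma atensor_lift_exists:
  fixes B :: "'a::complex_vector \<Rightarrow> 'b::complex_vector \<Rightarrow> 'c::complex_vector"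
  assumes B: "\<And>y. clinear (\<lambda>x. B x y)" "\<And>x. clinear (B x)"
  shows "\<exists>L. clinear L \<and> (\<forall>x y. L (atens x y) = B x y)"
proof -
  define F :: "(('a \<times> 'b) \<Rightarrow>\<^sub>0 complex) \<Rightarrow> 'c"
    where "F f = (\<Sum>k\<in>Poly_Mapping.keys f. Poly_Mapping.lookup f k *\<^sub>C B (fst k) (snd k))" for f
  have F: "F f = (\<Sum>k\<in>K. Poly_Mapping.lookup f k *\<^sub>C B (fst k) (snd k))"
    if "finite K" "Poly_Mapping.keys f \<subseteq> K" for f K
    unfolding F_def using that
    by (intro sum.mono_neutral_left) (auto simp: in_keys_iff)
  have add: "F (f + g) = F f + F g" for f g
  proof -
    let ?K = "Poly_Mapping.keys f \<union> Poly_Mapping.keys g"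
    have "Poly_Mapping.keys (f + g) \<subseteq> ?K" by (rule keys_add)
    then show ?thesis
      using F[of ?K f] F[of ?K g] F[of ?K "f + g"]
      by (simp add: lookup_add scaleC_add_left sum.distrib)
  qed
  have scale: "F (free_scale c f) = c *\<^sub>C F f" for c f
  proof -
    have "Poly_Mapping.keys (free_scale c f) \<subseteq> Poly_Mapping.keys f" by (auto simp: in_keys_iff)
    then show ?thesis
      using F[of "Poly_Mapping.keys f" "free_scale c f"] F[of "Poly_Mapping.keys f" f]
      by (simp add: complex_vector.scale_sum_right scaleC_scaleC)
  qed
  have diff: "F (f - g) = F f - F g" for f g
    using add[of "f - g" g] by simp
  have single: "F (Poly_Mapping.single (x, y) 1) = B x y" for x y
    by (simp add: F_def scaleC_one)
  have zero: "F f = 0" if "f \<in> free.span bilinear_relations" for f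
    using that
  proof (induct rule: free.span_induct_alt)
    case base
    then show ?case by (simp add: F_def)
  next
    case (step c f g)
    have "F f = 0" using step(1)
      unfolding bilinear_relations_def
      by (auto simp: diff scale single clinearD[OF B(1)] clinearD[OF B(2)])
    then show ?case by (simp add: add scale step)
  qed
  define L where "L u = F (rep_atensor u)" for u
  have L: "L (abs_atensor f) = F f" for f
  proof -
    have "tensor_eq (rep_atensor (abs_atensor f)) f"
      by (rule Quotient3_rep_abs[OF Quotient3_atensor]) (simp add: tensor_eq_def free.span_zero)
    then have "F (rep_atensor (abs_atensor f) - f) = 0" unfolding tensor_eq_def by (rule zero)
    then show ?thesis by (simp add: L_def diff)
  qed
  have rep: "\<exists>f. u = abs_atensor f" for u :: "('a, 'b) atensor"
    using Quotient3_abs_rep[OF Quotient3_atensor, of u] by metis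
  have "clinear L"
    unfolding clinear_def
  proof safe
    fix u v :: "('a, 'b) atensor" and c
    obtain f g where "u = abs_atensor f" "v = abs_atensor g" using rep by blast
    then show "L (u + v) = L u + L v" "L (c *\<^sub>C u) = c *\<^sub>C L u"
      by (simp_all add: atensor_plus_abs scaleC_atensor.abs_eq L add scale)
  qed
  moreover have "L (atens x y) = B x y" for x y
    by (simp add: atens.abs_eq L single)
  ultimately show ?thesis by blast
qed


section \<open>The projective tensor product\<close>

definition proj_norm :: "('a::complex_normed_vector, 'b::complex_normed_vector) atensor \<Rightarrow> real"
  where "proj_norm u = Inf {\<Sum>(x, y)\<leftarrow>xs. norm x * norm y | xs. u = (\<Sum>(x, y)\<leftarrow>xs. atens x y)}"

definition cost :: "('a::complex_normed_vector \<times> 'b::complex_normed_vector) list \<Rightarrow> real"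
  where "cost xs = (\<Sum>(x, y)\<leftarrow>xs. norm x * norm y)"

lemma cost_simps [simp]:
  "cost [] = 0" "cost (p # xs) = norm (fst p) * norm (snd p) + cost xs"
  "cost (xs @ ys) = cost xs + cost ys"
  by (simp_all add: cost_def case_prod_beta)

lemma cost_nonneg [simp]: "0 \<le> cost xs"
  by (induct xs) auto

lemma proj_norm_eq: "proj_norm u = Inf {cost xs | xs. u = atens_sum xs}"
  by (simp add: proj_norm_def cost_def atens_sum_def)

lemma proj_norm_le: "proj_norm (atens_sum xs) \<le> cost xs"
  unfolding proj_norm_eq by (rule cInf_lower) (auto intro!: bdd_belowI[of _ 0])

lemma proj_norm_approx:
  assumes "proj_norm u < r"
  shows "\<exists>xs. u = atens_sum xs \<and> cost xs < r"
proof -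
  have "{cost xs | xs. u = atens_sum xs} \<noteq> {}" using atens_sum_exists[of u] by auto
  from cInf_lessD[OF this] assms show ?thesis unfolding proj_norm_eq by blast
qed

lemma proj_norm_nonneg [simp]: "0 \<le> proj_norm u"
  unfolding proj_norm_eq using atens_sum_exists[of u] by (intro cInf_greatest) auto

lemma proj_norm_zero [simp]: "proj_norm 0 = 0"
  by (rule antisym) (use proj_norm_le[of "[]"] in simp_all)

lemma proj_norm_triangle: "proj_norm (u + v) \<le> proj_norm u + proj_norm v"
proof (rule field_le_epsilon)
  fix e :: real assume "0 < e"
  then obtain xs ys where "u = atens_sum xs" "cost xs < proj_norm u + e / 2"
    and "v = atens_sum ys" "cost ys < proj_norm v + e / 2"
    using proj_norm_approx[of u "proj_norm u + e / 2"] proj_norm_approx[of v "proj_norm v + e / 2"]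
    by auto
  then show "proj_norm (u + v) \<le> proj_norm u + proj_norm v + e"
    using proj_norm_le[of "xs @ ys"] by simp
qed

lemma proj_norm_scaleC_le: "proj_norm (c *\<^sub>C u) \<le> norm c * proj_norm u"
proof (rule field_le_epsilon)
  fix e :: real assume "0 < e"
  define d where "d = e / (norm c + 1)"
  have n: "norm c + 1 > 0" by (simp add: add_nonneg_pos)
  then have "d > 0" using \<open>0 < e\<close> by (simp add: d_def)
  then obtain xs where xs: "u = atens_sum xs" "cost xs < proj_norm u + d"
    using proj_norm_approx[of u "proj_norm u + d"] by auto
  have "cost (map (\<lambda>(x, y). (c *\<^sub>C x, y)) xs) = norm c * cost xs" for xs :: "('a \<times> 'b) list"
    by (induct xs) (auto simp: norm_scaleC algebra_simps)
  then have "proj_norm (c *\<^sub>C u) \<le> norm c * cost xs"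
    using proj_norm_le[of "map (\<lambda>(x, y). (c *\<^sub>C x, y)) xs"] xs(1) by (simp add: atens_sum_scaleC)
  also have "\<dots> \<le> norm c * (proj_norm u + d)" using xs(2) by (intro mult_left_mono) auto
  also have "\<dots> \<le> norm c * proj_norm u + (norm c + 1) * d"
    using \<open>d > 0\<close> by (simp add: algebra_simps)
  also have "(norm c + 1) * d = e" using n by (simp add: d_def)
  finally show "proj_norm (c *\<^sub>C u) \<le> norm c * proj_norm u + e" .
qed

lemma proj_norm_scaleC: "proj_norm (c *\<^sub>C u) = norm c * proj_norm u"
proof (cases "c = 0")
  case False
  have "proj_norm u = proj_norm (inverse c *\<^sub>C c *\<^sub>C u)"
    using False by (simp add: scaleC_scaleC scaleC_one)
  also have "\<dots> \<le> norm (inverse c) * proj_norm (c *\<^sub>C u)" by (rule proj_norm_scaleC_le)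
  finally have "norm c * proj_norm u \<le> proj_norm (c *\<^sub>C u)"
    using False by (simp only: norm_inverse) (simp add: divide_simps mult.commute)
  then show ?thesis using proj_norm_scaleC_le[of c u] by simp
qed simp

lemma proj_norm_minus: "proj_norm (- u) = proj_norm u"
  using proj_norm_scaleC[of "-1" u] by (simp add: scaleC_one)

lemma proj_norm_diff_commute: "proj_norm (u - v) = proj_norm (v - u)"
  using proj_norm_minus[of "u - v"] by simp

lemma proj_norm_reverse: "\<bar>proj_norm u - proj_norm v\<bar> \<le> proj_norm (u - v)"
  using proj_norm_triangle[of "u - v" v] proj_norm_triangle[of "v - u" u]
    proj_norm_diff_commute[of u v] by auto

lemma proj_norm_diff_triangle: "proj_norm (u - w) \<le> proj_norm (u - v) + proj_norm (v - w)"
  using proj_norm_triangle[of "u - v" "v - w"] by simp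

lemma proj_norm_atens_le: "proj_norm (atens x y) \<le> norm x * norm y"
  using proj_norm_le[of "[(x, y)]"] by simp

text \<open>The completion, as Cauchy sequences modulo null sequences. Factoring out null sequences
  makes it unnecessary to know beforehand that \<open>proj_norm\<close> is definite.\<close>

definition proj_Cauchy ::
    "(nat \<Rightarrow> ('a::complex_normed_vector, 'b::complex_normed_vector) atensor) \<Rightarrow> bool"
  where "proj_Cauchy f \<longleftrightarrow> (\<forall>e>0. \<exists>N. \<forall>m\<ge>N. \<forall>n\<ge>N. proj_norm (f m - f n) < e)"

definition proj_eq ::
    "(nat \<Rightarrow> ('a::complex_normed_vector, 'b::complex_normed_vector) atensor) \<Rightarrow>
     (nat \<Rightarrow> ('a, 'b) atensor) \<Rightarrow> bool"
  where "proj_eq f g \<longleftrightarrow>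
    proj_Cauchy f \<and> proj_Cauchy g \<and> (\<lambda>n. proj_norm (f n - g n)) \<longlonglongrightarrow> 0"

lemma proj_Cauchy_const: "proj_Cauchy (\<lambda>n. u)"
  by (simp add: proj_Cauchy_def)

lemma proj_eq_refl: "proj_eq f f \<longleftrightarrow> proj_Cauchy f"
  by (simp add: proj_eq_def)

lemma proj_Cauchy_add:
  assumes "proj_Cauchy f" "proj_Cauchy g"
  shows "proj_Cauchy (\<lambda>n. f n + g n)"
  unfolding proj_Cauchy_def
proof safe
  fix e :: real assume "e > 0"
  then obtain M N where M: "\<And>m n. m \<ge> M \<Longrightarrow> n \<ge> M \<Longrightarrow> proj_norm (f m - f n) < e / 2"
    and N: "\<And>m n. m \<ge> N \<Longrightarrow> n \<ge> N \<Longrightarrow> proj_norm (g m - g n) < e / 2"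
    using assms unfolding proj_Cauchy_def by (meson half_gt_zero)
  have "proj_norm (f m + g m - (f n + g n)) < e" if "m \<ge> max M N" "n \<ge> max M N" for m n
    using M[of m n] N[of m n] that proj_norm_triangle[of "f m - f n" "g m - g n"]
    by (simp add: add_diff_add)
  then show "\<exists>N. \<forall>m\<ge>N. \<forall>n\<ge>N. proj_norm (f m + g m - (f n + g n)) < e" by blast
qed

lemma proj_Cauchy_scaleC:
  assumes "proj_Cauchy f"
  shows "proj_Cauchy (\<lambda>n. c *\<^sub>C f n)"
  unfolding proj_Cauchy_def
proof safe
  fix e :: real assume "e > 0"
  have n: "norm c + 1 > 0" by (simp add: add_nonneg_pos)
  then have "e / (norm c + 1) > 0" using \<open>e > 0\<close> by simp
  then obtain N where N: "\<And>m n. m \<ge> N \<Longrightarrow> n \<ge> N \<Longrightarrow> proj_norm (f m - f n) < e / (norm c + 1)"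
    using assms unfolding proj_Cauchy_def by blast
  have "proj_norm (c *\<^sub>C f m - c *\<^sub>C f n) < e" if "m \<ge> N" "n \<ge> N" for m n
  proof -
    have "proj_norm (c *\<^sub>C f m - c *\<^sub>C f n) = norm c * proj_norm (f m - f n)"
      by (simp add: proj_norm_scaleC flip: complex_vector.scale_right_diff_distrib)
    also have "\<dots> \<le> (norm c + 1) * proj_norm (f m - f n)" by (intro mult_right_mono) auto
    also have "\<dots> < e" using N[OF that] n by (simp add: field_simps)
    finally show ?thesis .
  qed
  then show "\<exists>N. \<forall>m\<ge>N. \<forall>n\<ge>N. proj_norm (c *\<^sub>C f m - c *\<^sub>C f n) < e" by blast
qed

lemma proj_eq_add:
  assumes "proj_eq f f'" "proj_eq g g'"
  shows "proj_eq (\<lambda>n. f n + g n) (\<lambda>n. f' n + g' n)"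
proof -
  have "(\<lambda>n. proj_norm (f n + g n - (f' n + g' n))) \<longlonglongrightarrow> 0"
  proof (rule tendsto_sandwich[OF _ _ tendsto_const])
    show "\<forall>\<^sub>F n in sequentially. proj_norm (f n + g n - (f' n + g' n)) \<le>
        proj_norm (f n - f' n) + proj_norm (g n - g' n)"
      by (intro always_eventually allI) (metis add_diff_add proj_norm_triangle)
    show "(\<lambda>n. proj_norm (f n - f' n) + proj_norm (g n - g' n)) \<longlonglongrightarrow> 0"
      using assms tendsto_add[of _ 0 _ _ 0] by (auto simp: proj_eq_def)
  qed simp
  then show ?thesis using assms by (simp add: proj_eq_def proj_Cauchy_add)
qed

lemma proj_eq_scaleC:
  assumes "proj_eq f g"
  shows "proj_eq (\<lambda>n. c *\<^sub>C f n) (\<lambda>n. c *\<^sub>C g n)"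
proof -
  have "(\<lambda>n. norm c * proj_norm (f n - g n)) \<longlonglongrightarrow> norm c * 0"
    using assms by (intro tendsto_mult tendsto_const) (auto simp: proj_eq_def)
  then have "(\<lambda>n. proj_norm (c *\<^sub>C f n - c *\<^sub>C g n)) \<longlonglongrightarrow> 0"
    by (simp add: proj_norm_scaleC flip: complex_vector.scale_right_diff_distrib)
  then show ?thesis using assms by (simp add: proj_eq_def proj_Cauchy_scaleC)
qed

lemma proj_Cauchy_norm_convergent:
  assumes "proj_Cauchy f"
  shows "convergent (\<lambda>n. proj_norm (f n))"
proof (rule Cauchy_convergent, rule metric_CauchyI)
  fix e :: real assume "e > 0"
  then obtain N where "\<And>m n. m \<ge> N \<Longrightarrow> n \<ge> N \<Longrightarrow> proj_norm (f m - f n) < e"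
    using assms unfolding proj_Cauchy_def by blast
  then show "\<exists>N. \<forall>m\<ge>N. \<forall>n\<ge>N. dist (proj_norm (f m)) (proj_norm (f n)) < e"
    unfolding dist_real_def by (meson proj_norm_reverse order.strict_trans1)
qed

lemma proj_eq_norm_lim:
  assumes "proj_eq f g"
  shows "lim (\<lambda>n. proj_norm (f n)) = lim (\<lambda>n. proj_norm (g n))"
proof -
  have "(\<lambda>n. proj_norm (f n) - proj_norm (g n)) \<longlonglongrightarrow> 0"
    by (rule tendsto_rabs_zero_cancel, rule tendsto_sandwich[OF _ _ tendsto_const])
      (use assms in \<open>auto simp: proj_eq_def intro!: always_eventually proj_norm_reverse\<close>)
  moreover have "(\<lambda>n. proj_norm (g n)) \<longlonglongrightarrow> lim (\<lambda>n. proj_norm (g n))"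
    using assms proj_Cauchy_norm_convergent by (auto simp: proj_eq_def convergent_LIMSEQ_iff)
  ultimately have "(\<lambda>n. proj_norm (f n)) \<longlonglongrightarrow> lim (\<lambda>n. proj_norm (g n))"
    using tendsto_add[of _ 0 _ "\<lambda>n. proj_norm (g n)"] by fastforce
  then show ?thesis by (rule limI)
qed

quotient_type (overloaded) ('a, 'b) ptensor =
  "nat \<Rightarrow> ('a::complex_normed_vector, 'b::complex_normed_vector) atensor" / partial: proj_eq
proof (rule part_equivpI)
  show "\<exists>f :: nat \<Rightarrow> ('a, 'b) atensor. proj_eq f f"
    using proj_Cauchy_const by (auto simp: proj_eq_refl)
  show "symp (proj_eq :: (nat \<Rightarrow> ('a, 'b) atensor) \<Rightarrow> _)"
    by (auto simp: symp_def proj_eq_def proj_norm_diff_commute)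
  show "transp (proj_eq :: (nat \<Rightarrow> ('a, 'b) atensor) \<Rightarrow> _)"
  proof (rule transpI)
    fix f g h :: "nat \<Rightarrow> ('a, 'b) atensor"
    assume fg: "proj_eq f g" and gh: "proj_eq g h"
    have "(\<lambda>n. proj_norm (f n - h n)) \<longlonglongrightarrow> 0"
    proof (rule tendsto_sandwich[OF _ _ tendsto_const])
      show "\<forall>\<^sub>F n in sequentially. proj_norm (f n - h n) \<le>
          proj_norm (f n - g n) + proj_norm (g n - h n)"
        by (simp add: proj_norm_diff_triangle)
      show "(\<lambda>n. proj_norm (f n - g n) + proj_norm (g n - h n)) \<longlonglongrightarrow> 0"
        using fg gh tendsto_add[of _ 0 _ _ 0] by (auto simp: proj_eq_def)
    qed simp
    then show "proj_eq f h" using fg gh by (simp add: proj_eq_def)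
  qed
qed

instantiation ptensor :: (complex_normed_vector, complex_normed_vector) complex_normed_vector
begin

lift_definition zero_ptensor :: "('a, 'b) ptensor" is "\<lambda>n. 0"
  by (simp add: proj_eq_refl proj_Cauchy_const)

lift_definition plus_ptensor :: "('a, 'b) ptensor \<Rightarrow> ('a, 'b) ptensor \<Rightarrow> ('a, 'b) ptensor"
  is "\<lambda>f g n. f n + g n"
  by (rule proj_eq_add)

lift_definition scaleC_ptensor :: "complex \<Rightarrow> ('a, 'b) ptensor \<Rightarrow> ('a, 'b) ptensor"
  is "\<lambda>c f n. c *\<^sub>C f n"
  by (rule proj_eq_scaleC)

lift_definition norm_ptensor :: "('a, 'b) ptensor \<Rightarrow> real"
  is "\<lambda>f. lim (\<lambda>n. proj_norm (f n))"
  by (rule proj_eq_norm_lim)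

definition uminus_ptensor :: "('a, 'b) ptensor \<Rightarrow> ('a, 'b) ptensor"
  where "uminus_ptensor u = (-1) *\<^sub>C u"

definition minus_ptensor :: "('a, 'b) ptensor \<Rightarrow> ('a, 'b) ptensor \<Rightarrow> ('a, 'b) ptensor"
  where "minus_ptensor u v = u + - v"

definition scaleR_ptensor :: "real \<Rightarrow> ('a, 'b) ptensor \<Rightarrow> ('a, 'b) ptensor"
  where "scaleR_ptensor r u = of_real r *\<^sub>C u"

definition sgn_ptensor :: "('a, 'b) ptensor \<Rightarrow> ('a, 'b) ptensor"
  where "sgn_ptensor u = inverse (norm u) *\<^sub>R u"

definition dist_ptensor :: "('a, 'b) ptensor \<Rightarrow> ('a, 'b) ptensor \<Rightarrow> real"
  where "dist_ptensor u v = norm (u - v)"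

definition uniformity_ptensor :: "(('a, 'b) ptensor \<times> ('a, 'b) ptensor) filter"
  where "uniformity_ptensor = (INF e\<in>{0 <..}. principal {(u, v). dist u v < e})"

definition open_ptensor :: "('a, 'b) ptensor set \<Rightarrow> bool"
  where "open_ptensor U \<longleftrightarrow> (\<forall>u\<in>U. \<forall>\<^sub>F (u', v) in uniformity. u' = u \<longrightarrow> v \<in> U)"

lemma abs_ptensor_exists: "\<exists>f. proj_Cauchy f \<and> u = abs_ptensor f" for u :: "('a, 'b) ptensor"
  using Quotient3_abs_rep[OF Quotient3_ptensor, of u] Quotient3_rep_reflp[OF Quotient3_ptensor, of u]
  by (intro exI[of _ "rep_ptensor u"]) (simp add: proj_eq_refl)

lemma abs_ptensor_simps:
  fixes f g :: "nat \<Rightarrow> ('a, 'b) atensor"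
  shows "proj_Cauchy f \<Longrightarrow> proj_Cauchy g \<Longrightarrow> abs_ptensor f + abs_ptensor g = abs_ptensor (\<lambda>n. f n + g n)"
    and "proj_Cauchy f \<Longrightarrow> c *\<^sub>C abs_ptensor f = abs_ptensor (\<lambda>n. c *\<^sub>C f n)"
    and "proj_Cauchy f \<Longrightarrow> (\<lambda>n. proj_norm (f n)) \<longlonglongrightarrow> norm (abs_ptensor f)"
  using proj_Cauchy_norm_convergent[of f]
  by (simp_all add: plus_ptensor.abs_eq scaleC_ptensor.abs_eq norm_ptensor.abs_eq proj_eq_refl
      convergent_LIMSEQ_iff)

instance
proof
  fix u v w :: "('a, 'b) ptensor" and c d :: complex and r s :: real and U :: "('a, 'b) ptensor set"
  obtain f where f: "proj_Cauchy f" "u = abs_ptensor f" using abs_ptensor_exists by blast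
  obtain g where g: "proj_Cauchy g" "v = abs_ptensor g" using abs_ptensor_exists by blast
  obtain h where h: "proj_Cauchy h" "w = abs_ptensor h" using abs_ptensor_exists by blast
  note C = f(1) g(1) h(1) proj_Cauchy_add proj_Cauchy_scaleC
  note S = f(2) g(2) h(2) abs_ptensor_simps(1,2)
  show "u + v + w = u + (v + w)" by (simp add: S C add.assoc)
  show "u + v = v + u" by (simp add: S C add.commute)
  show "0 + u = u" by (simp add: S C zero_ptensor_def proj_Cauchy_const)
  have "(-1) *\<^sub>C u + u = abs_ptensor (\<lambda>n. (-1) *\<^sub>C f n + f n)"
    by (simp only: S C)
  then show "- u + u = 0" by (simp add: zero_ptensor_def uminus_ptensor_def scaleC_one)
  show "u - v = u + - v" by (simp add: minus_ptensor_def)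
  show 1: "c *\<^sub>C (u + v) = c *\<^sub>C u + c *\<^sub>C v" for c by (simp add: S C scaleC_add_right)
  show 2: "(c + d) *\<^sub>C u = c *\<^sub>C u + d *\<^sub>C u" for c d by (simp add: S C scaleC_add_left)
  show 3: "c *\<^sub>C d *\<^sub>C u = (c * d) *\<^sub>C u" for c d by (simp add: S C scaleC_scaleC)
  have 4: "1 *\<^sub>C u = u" by (simp add: S C scaleC_one)
  show "of_real r *\<^sub>C u = r *\<^sub>R u" by (simp add: scaleR_ptensor_def)
  show "r *\<^sub>R (u + v) = r *\<^sub>R u + r *\<^sub>R v" by (simp add: scaleR_ptensor_def 1)
  show "(r + s) *\<^sub>R u = r *\<^sub>R u + s *\<^sub>R u" by (simp add: scaleR_ptensor_def 2)
  show "r *\<^sub>R s *\<^sub>R u = (r * s) *\<^sub>R u" by (simp add: scaleR_ptensor_def 3)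
  show "1 *\<^sub>R u = u" by (simp add: scaleR_ptensor_def 4)
  show "sgn u = inverse (norm u) *\<^sub>R u" by (simp add: sgn_ptensor_def)
  show "dist u v = norm (u - v)" by (simp add: dist_ptensor_def)
  show "uniformity = (INF e\<in>{0 <..}. principal {(u, v :: ('a, 'b) ptensor). dist u v < e})"
    by (simp add: uniformity_ptensor_def)
  show "open U \<longleftrightarrow> (\<forall>u\<in>U. \<forall>\<^sub>F (u', v) in uniformity. u' = u \<longrightarrow> v \<in> U)"
    by (simp add: open_ptensor_def)
  show "norm u = 0 \<longleftrightarrow> u = 0"
  proof
    assume "norm u = 0"
    then have "proj_eq f (\<lambda>n. 0)"
      using abs_ptensor_simps(3)[OF f(1)] f by (simp add: proj_eq_def proj_Cauchy_const)
    then show "u = 0"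
      using Quotient3_rel_abs[OF Quotient3_ptensor] f(2) by (simp add: zero_ptensor_def)
  next
    assume "u = 0"
    then show "norm u = 0"
      using abs_ptensor_simps(3)[OF proj_Cauchy_const[of 0]]
      by (simp add: zero_ptensor_def LIMSEQ_const_iff)
  qed
  show "norm (u + v) \<le> norm u + norm v"
  proof (rule LIMSEQ_le)
    show "(\<lambda>n. proj_norm (f n + g n)) \<longlonglongrightarrow> norm (u + v)"
      using abs_ptensor_simps(3)[of "\<lambda>n. f n + g n"] by (simp add: S C)
    show "(\<lambda>n. proj_norm (f n) + proj_norm (g n)) \<longlonglongrightarrow> norm u + norm v"
      unfolding f(2) g(2) by (intro tendsto_add abs_ptensor_simps(3) C)
  qed (simp add: proj_norm_triangle)
  show 5: "norm (c *\<^sub>C u) = norm c * norm u" for c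
  proof (rule LIMSEQ_unique)
    show "(\<lambda>n. proj_norm (c *\<^sub>C f n)) \<longlonglongrightarrow> norm (c *\<^sub>C u)"
      using abs_ptensor_simps(3)[of "\<lambda>n. c *\<^sub>C f n"] by (simp add: S C)
    show "(\<lambda>n. proj_norm (c *\<^sub>C f n)) \<longlonglongrightarrow> norm c * norm u"
      unfolding proj_norm_scaleC f(2) by (intro tendsto_mult tendsto_const abs_ptensor_simps(3) C)
  qed
  show "norm (r *\<^sub>R u) = \<bar>r\<bar> * norm u" by (simp add: scaleR_ptensor_def 5)
qed

end

definition of_atensor ::
    "('a::complex_normed_vector, 'b::complex_normed_vector) atensor \<Rightarrow> ('a, 'b) ptensor"
  where "of_atensor u = abs_ptensor (\<lambda>n. u)"

lemma clinear_of_atensor: "clinear of_atensor"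
  by (simp add: clinear_def of_atensor_def abs_ptensor_simps proj_Cauchy_const)

lemma norm_of_atensor: "norm (of_atensor u) = proj_norm u"
  using abs_ptensor_simps(3)[OF proj_Cauchy_const[of u]]
  by (simp add: of_atensor_def LIMSEQ_const_iff)

lemma abs_ptensor_LIMSEQ:
  assumes f: "proj_Cauchy f"
  shows "(\<lambda>n. of_atensor (f n)) \<longlonglongrightarrow> abs_ptensor f"
proof (rule metric_LIMSEQ_I)
  fix e :: real assume "e > 0"
  then obtain N where N: "\<And>m n. m \<ge> N \<Longrightarrow> n \<ge> N \<Longrightarrow> proj_norm (f m - f n) < e / 2"
    using f unfolding proj_Cauchy_def by (meson half_gt_zero)
  have "dist (of_atensor (f m)) (abs_ptensor f) < e" if "m \<ge> N" for m
  proof -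
    have C: "proj_Cauchy (\<lambda>n. f n + (-1) *\<^sub>C f m)"
      by (intro proj_Cauchy_add f proj_Cauchy_const)
    have "abs_ptensor f - of_atensor (f m) = abs_ptensor f + (-1) *\<^sub>C of_atensor (f m)"
      by (simp add: scaleC_one)
    also have "\<dots> = abs_ptensor (\<lambda>n. f n + (-1) *\<^sub>C f m)"
      by (simp add: of_atensor_def abs_ptensor_simps f proj_Cauchy_const
          del: complex_vector.scale_minus_left)
    finally have "(\<lambda>n. proj_norm (f n - f m)) \<longlonglongrightarrow> norm (abs_ptensor f - of_atensor (f m))"
      using abs_ptensor_simps(3)[OF C] by (simp add: scaleC_one)
    moreover have "\<forall>n\<ge>N. proj_norm (f n - f m) \<le> e / 2"
      using N that by (meson less_imp_le)
    ultimately have "norm (abs_ptensor f - of_atensor (f m)) \<le> e / 2"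
      by (meson LIMSEQ_le_const2)
    then show ?thesis using \<open>e > 0\<close> by (simp add: dist_norm norm_minus_commute)
  qed
  then show "\<exists>N. \<forall>m\<ge>N. dist (of_atensor (f m)) (abs_ptensor f) < e" by blast
qed

lemma of_atensor_dense: "e > 0 \<Longrightarrow> \<exists>w. dist (of_atensor w) u < e"
  using abs_ptensor_exists[of u] abs_ptensor_LIMSEQ metric_LIMSEQ_D by blast

lemma proj_Cauchy_iff: "proj_Cauchy f \<longleftrightarrow> Cauchy (\<lambda>n. of_atensor (f n))"
  by (simp add: proj_Cauchy_def Cauchy_def dist_norm norm_of_atensor
      flip: clinearD(5)[OF clinear_of_atensor])

instance ptensor :: (complex_normed_vector, complex_normed_vector) complex_banach
proof
  fix X :: "nat \<Rightarrow> ('a, 'b) ptensor" assume X: "Cauchy X"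
  have "\<exists>w. dist (of_atensor w) (X n) < inverse (real (Suc n))" for n
    by (rule of_atensor_dense) simp
  then obtain w where w: "\<And>n. dist (of_atensor (w n)) (X n) < inverse (real (Suc n))" by metis
  have null: "(\<lambda>n. of_atensor (w n) - X n) \<longlonglongrightarrow> 0"
    by (rule Lim_null_comparison[OF _ LIMSEQ_inverse_real_of_nat])
      (use w in \<open>auto intro!: always_eventually simp: dist_norm less_imp_le\<close>)
  have "Cauchy (\<lambda>n. of_atensor (w n))"
  proof (rule metric_CauchyI)
    fix e :: real assume "e > 0"
    then have "e / 3 > 0" by simp
    obtain N1 where N1: "\<And>n. n \<ge> N1 \<Longrightarrow> dist (of_atensor (w n)) (X n) < e / 3"
      using metric_LIMSEQ_D[OF null \<open>e / 3 > 0\<close>] by (auto simp: dist_norm)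
    obtain N2 where N2: "\<And>m n. m \<ge> N2 \<Longrightarrow> n \<ge> N2 \<Longrightarrow> dist (X m) (X n) < e / 3"
      using metric_CauchyD[OF X \<open>e / 3 > 0\<close>] by blast
    have "dist (of_atensor (w m)) (of_atensor (w n)) < e" if "m \<ge> max N1 N2" "n \<ge> max N1 N2" for m n
      using that N1[of m] N1[of n] N2[of m n]
        dist_triangle[of "of_atensor (w m)" "of_atensor (w n)" "X m"]
        dist_triangle[of "X m" "of_atensor (w n)" "X n"]
      by (simp add: dist_commute)
    then show "\<exists>N. \<forall>m\<ge>N. \<forall>n\<ge>N. dist (of_atensor (w m)) (of_atensor (w n)) < e" by blast
  qed
  then have "proj_Cauchy w" by (simp add: proj_Cauchy_iff)
  then have "(\<lambda>n. of_atensor (w n)) \<longlonglongrightarrow> abs_ptensor w" by (rule abs_ptensor_LIMSEQ)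
  from tendsto_diff[OF this null] show "convergent X" by (auto simp: convergent_def)
qed

definition ptens :: "'a::complex_normed_vector \<Rightarrow> 'b::complex_normed_vector \<Rightarrow> ('a, 'b) ptensor"
    (infixr \<open>\<otimes>\<^sub>p\<close> 70)
  where "x \<otimes>\<^sub>p y = of_atensor (atens x y)"

lemma bounded_cbilinear_ptens: "bounded_cbilinear (\<otimes>\<^sub>p)"
  unfolding bounded_cbilinear_def
proof safe
  fix x :: 'a and y :: 'b
  show "clinear (\<lambda>x. x \<otimes>\<^sub>p y)" "clinear ((\<otimes>\<^sub>p) x)"
    by (simp_all add: clinear_def ptens_def clinearD[OF clinear_of_atensor]
        atens_add_left atens_add_right atens_scaleC_left atens_scaleC_right)
  have "norm (x \<otimes>\<^sub>p y) \<le> norm x * norm y * 1" for x :: 'a and y :: 'b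
    by (simp add: ptens_def norm_of_atensor proj_norm_atens_le)
  then show "\<exists>K. \<forall>(x::'a) (y::'b). norm (x \<otimes>\<^sub>p y) \<le> norm x * norm y * K" by blast
qed

lemma norm_ptens_le: "norm (x \<otimes>\<^sub>p y) \<le> norm x * norm y"
  by (simp add: ptens_def norm_of_atensor proj_norm_atens_le)

lemma bounded_clinear_ptensor_eqI:
  fixes L M :: "('a::complex_normed_vector, 'b::complex_normed_vector) ptensor \<Rightarrow> 'c::complex_normed_vector"
  assumes L: "bounded_clinear L" and M: "bounded_clinear M"
    and eq: "\<And>x y. L (x \<otimes>\<^sub>p y) = M (x \<otimes>\<^sub>p y)"
  shows "L = M"
proof
  fix u :: "('a, 'b) ptensor"
  have lin: "clinear L" "clinear M" using L M by (auto simp: bounded_clinear_def)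
  have "L (of_atensor (atens_sum xs)) = M (of_atensor (atens_sum xs))"
    for xs :: "('a \<times> 'b) list"
    using eq by (induct xs)
      (simp_all add: clinearD[OF clinear_of_atensor] clinearD[OF lin(1)] clinearD[OF lin(2)] ptens_def)
  then have 1: "L (of_atensor w) = M (of_atensor w)" for w :: "('a, 'b) atensor"
    using atens_sum_exists[of w] by auto
  obtain f where f: "proj_Cauchy f" "u = abs_ptensor f" using abs_ptensor_exists by blast
  have "(\<lambda>n. L (of_atensor (f n))) \<longlonglongrightarrow> L u" "(\<lambda>n. M (of_atensor (f n))) \<longlonglongrightarrow> M u"
    using abs_ptensor_LIMSEQ[OF f(1)] f(2) L M
    by (auto intro: bounded_linear.tendsto bounded_clinear_bounded_linear)
  then show "L u = M u" unfolding 1 by (rule LIMSEQ_unique)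
qed

text \<open>The bounded linear map on the projective tensor product determined by its values on
  elementary tensors.\<close>

definition ptensor_lift ::
    "('a::complex_normed_vector \<Rightarrow> 'b::complex_normed_vector \<Rightarrow> 'c::complex_normed_vector) \<Rightarrow>
     ('a, 'b) ptensor \<Rightarrow> 'c"
  where "ptensor_lift B = (THE L. bounded_clinear L \<and> (\<forall>x y. L (x \<otimes>\<^sub>p y) = B x y))"

lemma ptensor_lift_ex1:
  fixes B :: "'a::complex_normed_vector \<Rightarrow> 'b::complex_normed_vector \<Rightarrow> 'c::complex_banach"
  assumes B: "bounded_cbilinear B"
  shows "\<exists>!L. bounded_clinear L \<and> (\<forall>x y. L (x \<otimes>\<^sub>p y) = B x y)"
proof -
  obtain K0 where K0: "\<And>x y. norm (B x y) \<le> norm x * norm y * K0"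
    using B by (auto simp: bounded_cbilinear_def)
  define K where "K = max K0 0"
  have "K \<ge> 0" by (simp add: K_def)
  have K: "norm (B x y) \<le> K * (norm x * norm y)" for x y
    using K0[of x y] mult_left_mono[of K0 K "norm x * norm y"] by (simp add: K_def mult.commute)
  obtain L0 where L0: "clinear L0" "\<And>x y. L0 (atens x y) = B x y"
    using atensor_lift_exists[of B] B by (auto simp: bounded_cbilinear_def)
  have "norm (L0 (atens_sum xs)) \<le> K * cost xs" for xs
  proof (induct xs)
    case (Cons p xs)
    then show ?case
      using norm_triangle_ineq[of "B (fst p) (snd p)" "L0 (atens_sum xs)"] K[of "fst p" "snd p"]
      by (simp add: clinearD[OF L0(1)] L0(2) algebra_simps)
  qed (simp add: clinearD[OF L0(1)])
  note cost = this
  have bnd: "norm (L0 w) \<le> K * proj_norm w" for w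
  proof (rule field_le_epsilon)
    fix e :: real assume "e > 0"
    then have d: "e / (K + 1) > 0" using \<open>K \<ge> 0\<close> by simp
    then obtain xs where xs: "w = atens_sum xs" "cost xs < proj_norm w + e / (K + 1)"
      using proj_norm_approx[of w "proj_norm w + e / (K + 1)"] by auto
    have "norm (L0 w) \<le> K * cost xs" using cost xs(1) by simp
    also have "\<dots> \<le> K * (proj_norm w + e / (K + 1))" using xs(2) \<open>K \<ge> 0\<close> by (intro mult_left_mono) auto
    also have "\<dots> \<le> K * proj_norm w + (K + 1) * (e / (K + 1))"
      using d unfolding distrib_left distrib_right by linarith
    also have "(K + 1) * (e / (K + 1)) = e" using \<open>K \<ge> 0\<close> by simp
    finally show "norm (L0 w) \<le> K * proj_norm w + e" .
  qed
  have conv: "convergent (\<lambda>n. L0 (f n))" if f: "proj_Cauchy f" for f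
  proof (rule Cauchy_convergent, rule metric_CauchyI)
    fix e :: real assume "e > 0"
    then have "e / (K + 1) > 0" using \<open>K \<ge> 0\<close> by simp
    then obtain N where N: "\<And>m n. m \<ge> N \<Longrightarrow> n \<ge> N \<Longrightarrow> proj_norm (f m - f n) < e / (K + 1)"
      using f unfolding proj_Cauchy_def by blast
    have "dist (L0 (f m)) (L0 (f n)) < e" if "m \<ge> N" "n \<ge> N" for m n
    proof -
      have "dist (L0 (f m)) (L0 (f n)) \<le> K * proj_norm (f m - f n)"
        using bnd[of "f m - f n"] by (simp add: dist_norm clinearD[OF L0(1)])
      also have "\<dots> \<le> (K + 1) * proj_norm (f m - f n)" by (intro mult_right_mono) auto
      also have "\<dots> < e" using N[OF that] \<open>K \<ge> 0\<close> by (simp add: field_simps)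
      finally show ?thesis .
    qed
    then show "\<exists>N. \<forall>m\<ge>N. \<forall>n\<ge>N. dist (L0 (f m)) (L0 (f n)) < e" by blast
  qed
  define r where "r u = (SOME f. proj_Cauchy f \<and> u = abs_ptensor f)" for u :: "('a, 'b) ptensor"
  have r: "proj_Cauchy (r u)" "abs_ptensor (r u) = u" for u
    using someI_ex[OF abs_ptensor_exists[of u]] by (auto simp: r_def)
  define L where "L u = lim (\<lambda>n. L0 (r u n))" for u
  have L: "(\<lambda>n. L0 (f n)) \<longlonglongrightarrow> L u" if f: "proj_Cauchy f" "u = abs_ptensor f" for f u
  proof -
    have "proj_eq f (r u)"
      using f r[of u] Quotient3_rel[OF Quotient3_ptensor, of f "r u"] by (simp add: proj_eq_refl)
    then have "(\<lambda>n. K * proj_norm (f n - r u n)) \<longlonglongrightarrow> K * 0"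
      by (intro tendsto_mult tendsto_const) (simp add: proj_eq_def)
    then have null: "(\<lambda>n. K * proj_norm (f n - r u n)) \<longlonglongrightarrow> 0" by simp
    have "norm (L0 (f n) - L0 (r u n)) \<le> K * proj_norm (f n - r u n)" for n
      using bnd[of "f n - r u n"] by (simp only: clinearD(5)[OF L0(1)])
    then have "(\<lambda>n. L0 (f n) - L0 (r u n)) \<longlonglongrightarrow> 0"
      by (rule Lim_null_comparison[OF always_eventually[OF allI] null])
    moreover have "(\<lambda>n. L0 (r u n)) \<longlonglongrightarrow> L u"
      using conv[OF r(1)] by (simp add: L_def convergent_LIMSEQ_iff)
    ultimately show ?thesis using tendsto_add[of "\<lambda>n. L0 (f n) - L0 (r u n)" 0] by fastforce
  qed
  have "clinear L"
    unfolding clinear_def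
  proof safe
    fix u v :: "('a, 'b) ptensor" and c
    have "(\<lambda>n. L0 (r u n + r v n)) \<longlonglongrightarrow> L (u + v)"
      by (rule L) (simp_all add: r proj_Cauchy_add flip: abs_ptensor_simps)
    moreover have "(\<lambda>n. L0 (r u n + r v n)) \<longlonglongrightarrow> L u + L v"
      unfolding clinearD[OF L0(1)] by (intro tendsto_add L) (simp_all add: r)
    ultimately show "L (u + v) = L u + L v" by (rule LIMSEQ_unique)
    have bl: "bounded_linear (\<lambda>z::'c. c *\<^sub>C z)"
      by (rule bounded_linear_intro[where K = "norm c"])
        (simp_all add: scaleC_add_right norm_scaleC scaleC_scaleC mult.commute flip: scaleC_of_real)
    have "(\<lambda>n. L0 (c *\<^sub>C r u n)) \<longlonglongrightarrow> L (c *\<^sub>C u)"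
      by (rule L) (simp_all add: r proj_Cauchy_scaleC flip: abs_ptensor_simps)
    moreover have "(\<lambda>n. L0 (c *\<^sub>C r u n)) \<longlonglongrightarrow> c *\<^sub>C L u"
      unfolding clinearD[OF L0(1)] by (intro bounded_linear.tendsto[OF bl] L) (simp_all add: r)
    ultimately show "L (c *\<^sub>C u) = c *\<^sub>C L u" by (rule LIMSEQ_unique)
  qed
  moreover have "norm (L u) \<le> norm u * K" for u
  proof (rule LIMSEQ_le)
    show "(\<lambda>n. norm (L0 (r u n))) \<longlonglongrightarrow> norm (L u)" by (intro tendsto_norm L) (simp_all add: r)
    show "(\<lambda>n. proj_norm (r u n) * K) \<longlonglongrightarrow> norm u * K"
      using abs_ptensor_simps(3)[OF r(1)[of u]] by (intro tendsto_mult tendsto_const) (simp add: r)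
  qed (use bnd in \<open>auto simp: mult.commute\<close>)
  ultimately have "bounded_clinear L" by (auto simp: bounded_clinear_def)
  moreover have "L (x \<otimes>\<^sub>p y) = B x y" for x y
    using L[OF proj_Cauchy_const refl, of "atens x y"]
    by (simp add: L0(2) ptens_def of_atensor_def LIMSEQ_const_iff)
  ultimately have LB: "bounded_clinear L \<and> (\<forall>x y. L (x \<otimes>\<^sub>p y) = B x y)" by blast
  show ?thesis
  proof (rule ex1I[of _ L])
    fix M assume "bounded_clinear M \<and> (\<forall>x y. M (x \<otimes>\<^sub>p y) = B x y)"
    with LB show "M = L" by (intro bounded_clinear_ptensor_eqI) auto
  qed (rule LB)
qed

lemma ptensor_lift:
  fixes B :: "'a::complex_normed_vector \<Rightarrow> 'b::complex_normed_vector \<Rightarrow> 'c::complex_banach"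
  assumes "bounded_cbilinear B"
  shows "bounded_clinear (ptensor_lift B)" "ptensor_lift B (x \<otimes>\<^sub>p y) = B x y"
  using theI'[OF ptensor_lift_ex1[OF assms]] by (auto simp: ptensor_lift_def)


section \<open>Banach algebras\<close>

text \<open>The product is a parameter rather than the type class operation because \<open>A\<close> and \<open>A\<^sub>e\<close>
  are two algebras on the same Banach space. No unit is assumed.\<close>

locale banach_algebra =
  fixes mul :: "'a::complex_banach \<Rightarrow> 'a \<Rightarrow> 'a"
  assumes mul_assoc: "mul (mul a b) c = mul a (mul b c)"
    and clinear_mult_left: "clinear (\<lambda>a. mul a b)"
    and clinear_mult_right: "clinear (\<lambda>b. mul a b)"
    and norm_mult_le: "norm (mul a b) \<le> norm a * norm b"

definition unital :: "('a \<Rightarrow> 'a \<Rightarrow> 'a) \<Rightarrow> bool"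
  where "unital mul \<longleftrightarrow> (\<exists>u. \<forall>a. mul u a = a \<and> mul a u = a)"

definition twisted_mult :: "('a \<Rightarrow> 'a \<Rightarrow> 'a) \<Rightarrow> 'a \<Rightarrow> 'a \<Rightarrow> 'a \<Rightarrow> 'a"
  where "twisted_mult mul e a b = mul (mul a e) b"

definition left_action ::
    "('a::complex_banach \<Rightarrow> 'a \<Rightarrow> 'a) \<Rightarrow> 'a \<Rightarrow> ('a, 'a) ptensor \<Rightarrow> ('a, 'a) ptensor"
  where "left_action mul a = ptensor_lift (\<lambda>b c. mul a b \<otimes>\<^sub>p c)"

definition right_action ::
    "('a::complex_banach \<Rightarrow> 'a \<Rightarrow> 'a) \<Rightarrow> ('a, 'a) ptensor \<Rightarrow> 'a \<Rightarrow> ('a, 'a) ptensor"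
  where "right_action mul u a = ptensor_lift (\<lambda>b c. b \<otimes>\<^sub>p mul c a) u"

definition product_map :: "('a::complex_banach \<Rightarrow> 'a \<Rightarrow> 'a) \<Rightarrow> ('a, 'a) ptensor \<Rightarrow> 'a"
  where "product_map mul = ptensor_lift mul"

lemma clinear_compose: "clinear f \<Longrightarrow> clinear g \<Longrightarrow> clinear (\<lambda>x. f (g x))"
  by (simp add: clinear_def)

lemma clinear_ptens: "clinear (\<lambda>x. x \<otimes>\<^sub>p y)" "clinear (\<lambda>y. x \<otimes>\<^sub>p y)"
  using bounded_cbilinear_ptens by (auto simp: bounded_cbilinear_def)

lemma clinear_ident: "clinear (\<lambda>x. x)"
  by (simp add: clinear_def)

context banach_algebra
begin

lemma bounded_cbilinear_mult: "bounded_cbilinear mul"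
proof -
  have "norm (mul x y) \<le> norm x * norm y * 1" for x y using norm_mult_le by simp
  then show ?thesis
    unfolding bounded_cbilinear_def using clinear_mult_left clinear_mult_right by blast
qed

lemma bounded_cbilinear_left_action: "bounded_cbilinear (\<lambda>b c. mul a b \<otimes>\<^sub>p (c :: 'a))"
proof -
  have lin: "clinear (\<lambda>b. mul a b \<otimes>\<^sub>p c)" for c :: 'a
    by (rule clinear_compose[OF clinear_ptens(1) clinear_mult_right])
  have h: "norm (mul a b \<otimes>\<^sub>p c) \<le> (norm a * norm b) * norm c" for b c :: 'a
    by (rule order_trans[OF norm_ptens_le]) (intro mult_right_mono norm_mult_le norm_ge_zero)
  have "norm (mul a b \<otimes>\<^sub>p c) \<le> norm b * norm c * norm a" for b c :: 'a
    using h[of b c] by (simp only: ac_simps)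
  then show ?thesis
    unfolding bounded_cbilinear_def using lin clinear_ptens(2) by blast
qed

lemma bounded_cbilinear_right_action: "bounded_cbilinear (\<lambda>b c. (b :: 'a) \<otimes>\<^sub>p mul c a)"
proof -
  have lin: "clinear (\<lambda>c. b \<otimes>\<^sub>p mul c a)" for b :: 'a
    by (rule clinear_compose[OF clinear_ptens(2) clinear_mult_left])
  have h: "norm (b \<otimes>\<^sub>p mul c a) \<le> norm b * (norm c * norm a)" for b c :: 'a
    by (rule order_trans[OF norm_ptens_le]) (intro mult_left_mono norm_mult_le norm_ge_zero)
  have "norm (b \<otimes>\<^sub>p mul c a) \<le> norm b * norm c * norm a" for b c :: 'a
    using h[of b c] by (simp only: ac_simps)
  then show ?thesis
    unfolding bounded_cbilinear_def using lin clinear_ptens(1) by blast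
qed

lemma left_action:
  "bounded_clinear (left_action mul a)"
  "left_action mul a (b \<otimes>\<^sub>p c) = mul a b \<otimes>\<^sub>p c"
  unfolding left_action_def
  by (rule ptensor_lift[OF bounded_cbilinear_left_action])+

lemma right_action:
  "bounded_clinear (\<lambda>u. right_action mul u a)"
  "right_action mul (b \<otimes>\<^sub>p c) a = b \<otimes>\<^sub>p mul c a"
  unfolding right_action_def
  by (rule ptensor_lift[OF bounded_cbilinear_right_action])+

lemma product_map:
  "bounded_clinear (product_map mul)"
  "product_map mul (b \<otimes>\<^sub>p c) = mul b c"
  unfolding product_map_def
  by (rule ptensor_lift[OF bounded_cbilinear_mult])+

lemma banach_algebra_twisted:
  assumes "norm e \<le> 1"
  shows "banach_algebra (twisted_mult mul e)"
proof
  fix a b c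
  show "twisted_mult mul e (twisted_mult mul e a b) c = twisted_mult mul e a (twisted_mult mul e b c)"
    by (simp add: twisted_mult_def mul_assoc)
  show "clinear (\<lambda>a. twisted_mult mul e a b)" "clinear (\<lambda>b. twisted_mult mul e a b)"
    unfolding twisted_mult_def
    by (rule clinear_compose[OF clinear_mult_left clinear_mult_left] clinear_mult_right)+
  have "norm (mul a e) \<le> norm a * 1"
    by (rule order_trans[OF norm_mult_le]) (intro mult_left_mono assms norm_ge_zero)
  then have "norm (mul a e) * norm b \<le> norm a * norm b"
    by (intro mult_right_mono) auto
  then show "norm (twisted_mult mul e a b) \<le> norm a * norm b"
    unfolding twisted_mult_def by (rule order_trans[OF norm_mult_le])
qed

end


section \<open>Approximate biprojectivity\<close>

definition directed_set :: "'i set \<Rightarrow> ('i \<Rightarrow> 'i \<Rightarrow> bool) \<Rightarrow> bool"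
  where "directed_set D le \<longleftrightarrow> D \<noteq> {} \<and> (\<forall>i\<in>D. le i i) \<and>
    (\<forall>i\<in>D. \<forall>j\<in>D. \<forall>k\<in>D. le i j \<longrightarrow> le j k \<longrightarrow> le i k) \<and>
    (\<forall>i\<in>D. \<forall>j\<in>D. \<exists>k\<in>D. le i k \<and> le j k)"

text \<open>The filter of tails, so that convergence of a net along \<open>D\<close> is convergence along it.\<close>

definition tails :: "'i set \<Rightarrow> ('i \<Rightarrow> 'i \<Rightarrow> bool) \<Rightarrow> 'i filter"
  where "tails D le = (INF i\<in>D. principal {j\<in>D. le i j})"

lemma eventually_tails:
  assumes "directed_set D le"
  shows "eventually P (tails D le) \<longleftrightarrow> (\<exists>i\<in>D. \<forall>j\<in>D. le i j \<longrightarrow> P j)"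
  unfolding tails_def
proof (subst eventually_INF_base)
  show "D \<noteq> {}" using assms by (simp add: directed_set_def)
  fix i j assume "i \<in> D" "j \<in> D"
  then obtain k where "k \<in> D" "le i k" "le j k" using assms unfolding directed_set_def by blast
  moreover from this have "{l\<in>D. le k l} \<subseteq> {l\<in>D. le i l} \<inter> {l\<in>D. le j l}"
    using assms \<open>i \<in> D\<close> \<open>j \<in> D\<close> unfolding directed_set_def by blast
  ultimately show "\<exists>k\<in>D. principal {l\<in>D. le k l} \<le> inf (principal {l\<in>D. le i l}) (principal {l\<in>D. le j l})"
    by (auto simp: principal_le_iff intro!: bexI[of _ k])
qed (auto simp: eventually_principal)

lemma eventually_tails_ex:
  assumes "directed_set D le" and "eventually P (tails D le)"
  shows "\<exists>i\<in>D. P i"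
  using assms(2) unfolding eventually_tails[OF assms(1)]
  using assms(1) unfolding directed_set_def by metis

definition approx_biprojective_net ::
    "('a::complex_banach \<Rightarrow> 'a \<Rightarrow> 'a) \<Rightarrow> 'i set \<Rightarrow> ('i \<Rightarrow> 'i \<Rightarrow> bool) \<Rightarrow>
     ('i \<Rightarrow> 'a \<Rightarrow> ('a, 'a) ptensor) \<Rightarrow> bool"
  where "approx_biprojective_net mul D le \<rho> \<longleftrightarrow>
    directed_set D le \<and>
    (\<forall>\<alpha>\<in>D. bounded_clinear (\<rho> \<alpha>)) \<and>
    (\<forall>a b. ((\<lambda>\<alpha>. left_action mul a (\<rho> \<alpha> b) - \<rho> \<alpha> (mul a b)) \<longlongrightarrow> 0) (tails D le)) \<and>
    (\<forall>a b. ((\<lambda>\<alpha>. \<rho> \<alpha> (mul b a) - right_action mul (\<rho> \<alpha> b) a) \<longlongrightarrow> 0) (tails D le)) \<and>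
    (\<forall>a. ((\<lambda>\<alpha>. product_map mul (\<rho> \<alpha> a) - a) \<longlongrightarrow> 0) (tails D le))"

text \<open>HOL cannot quantify over the type of indices. Fixing it to \<open>'a set \<times> nat\<close> loses nothing:
  by the lemma below, a net over any index type yields one over this type.\<close>

definition approximately_biprojective :: "('a::complex_banach \<Rightarrow> 'a \<Rightarrow> 'a) \<Rightarrow> bool"
  where "approximately_biprojective mul \<longleftrightarrow>
    (\<exists>(D :: ('a set \<times> nat) set) le \<rho>. approx_biprojective_net mul D le \<rho>)"

lemma approximately_biprojectiveI:
  fixes mul :: "'a::complex_banach \<Rightarrow> 'a \<Rightarrow> 'a"
  assumes net: "approx_biprojective_net mul (D :: 'i set) le \<rho>"
  shows "approximately_biprojective mul"
proof -
  have dir: "directed_set D le" using net by (simp add: approx_biprojective_net_def)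
  define good where "good S n \<alpha> \<longleftrightarrow> \<alpha> \<in> D \<and> (\<forall>a\<in>S. \<forall>b\<in>S.
      norm (left_action mul a (\<rho> \<alpha> b) - \<rho> \<alpha> (mul a b)) < inverse (real (Suc n)) \<and>
      norm (\<rho> \<alpha> (mul b a) - right_action mul (\<rho> \<alpha> b) a) < inverse (real (Suc n)) \<and>
      norm (product_map mul (\<rho> \<alpha> a) - a) < inverse (real (Suc n)))" for S :: "'a set" and n \<alpha>
  have "\<exists>\<alpha>. good S n \<alpha>" if "finite S" for S n
  proof -
    have pos: "inverse (real (Suc n)) > 0" by simp
    have "\<forall>\<^sub>F \<alpha> in tails D le. \<forall>a\<in>S. \<forall>b\<in>S.
      norm (left_action mul a (\<rho> \<alpha> b) - \<rho> \<alpha> (mul a b)) < inverse (real (Suc n)) \<and>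
      norm (\<rho> \<alpha> (mul b a) - right_action mul (\<rho> \<alpha> b) a) < inverse (real (Suc n)) \<and>
      norm (product_map mul (\<rho> \<alpha> a) - a) < inverse (real (Suc n))"
    proof (intro eventually_ball_finite[OF that] ballI eventually_conj)
      fix a b
      have lim: "((\<lambda>\<alpha>. left_action mul a (\<rho> \<alpha> b) - \<rho> \<alpha> (mul a b)) \<longlongrightarrow> 0) (tails D le)"
        "((\<lambda>\<alpha>. \<rho> \<alpha> (mul b a) - right_action mul (\<rho> \<alpha> b) a) \<longlongrightarrow> 0) (tails D le)"
        "((\<lambda>\<alpha>. product_map mul (\<rho> \<alpha> a) - a) \<longlongrightarrow> 0) (tails D le)"
        using net unfolding approx_biprojective_net_def by blast+
      show "\<forall>\<^sub>F \<alpha> in tails D le.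
          norm (left_action mul a (\<rho> \<alpha> b) - \<rho> \<alpha> (mul a b)) < inverse (real (Suc n))"
        using tendstoD[OF lim(1) pos] by (simp only: dist_norm diff_zero)
      show "\<forall>\<^sub>F \<alpha> in tails D le.
          norm (\<rho> \<alpha> (mul b a) - right_action mul (\<rho> \<alpha> b) a) < inverse (real (Suc n))"
        using tendstoD[OF lim(2) pos] by (simp only: dist_norm diff_zero)
      show "\<forall>\<^sub>F \<alpha> in tails D le. norm (product_map mul (\<rho> \<alpha> a) - a) < inverse (real (Suc n))"
        using tendstoD[OF lim(3) pos] by (simp only: dist_norm diff_zero)
    qed
    from eventually_tails_ex[OF dir this] show ?thesis unfolding good_def by blast
  qed
  then obtain c where c: "\<And>S n. finite S \<Longrightarrow> good S n (c S n)" by metis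
  define E :: "('a set \<times> nat) set" where "E = {p. finite (fst p)}"
  define sub where "sub p q \<longleftrightarrow> fst p \<subseteq> fst q \<and> snd p \<le> snd q" for p q :: "'a set \<times> nat"
  define \<sigma> where "\<sigma> p = \<rho> (c (fst p) (snd p))" for p
  have E: "directed_set E sub"
    unfolding directed_set_def
  proof (intro conjI ballI impI)
    show "E \<noteq> {}" by (auto simp: E_def)
    fix p q assume "p \<in> E" "q \<in> E"
    then show "\<exists>k\<in>E. sub p k \<and> sub q k"
      by (intro bexI[of _ "(fst p \<union> fst q, max (snd p) (snd q))"]) (auto simp: E_def sub_def)
  qed (auto simp: sub_def)
  have ev: "(X \<longlongrightarrow> 0) (tails E sub)"
    if "finite S" and X: "\<And>p. p \<in> E \<Longrightarrow> S \<subseteq> fst p \<Longrightarrow> norm (X p) < inverse (real (Suc (snd p)))"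
    for X :: "'a set \<times> nat \<Rightarrow> 'b::real_normed_vector" and S
  proof (rule tendstoI)
    fix r :: real assume "r > 0"
    then obtain n where n: "inverse (real (Suc n)) < r" using reals_Archimedean by blast
    have "norm (X p) < r" if "p \<in> E" "sub (S, n) p" for p
    proof -
      have "inverse (real (Suc (snd p))) \<le> inverse (real (Suc n))"
        using that by (simp add: sub_def)
      moreover have "norm (X p) < inverse (real (Suc (snd p)))"
        using that by (intro X) (auto simp: sub_def)
      ultimately show ?thesis using n by linarith
    qed
    moreover have "(S, n) \<in> E" using \<open>finite S\<close> by (simp add: E_def)
    ultimately show "\<forall>\<^sub>F p in tails E sub. dist (X p) 0 < r"
      unfolding eventually_tails[OF E] dist_norm diff_zero by blast
  qed
  have g: "good (fst p) (snd p) (c (fst p) (snd p))" if "p \<in> E" for p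
    using that c by (simp add: E_def)
  have "approx_biprojective_net mul E sub \<sigma>"
    unfolding approx_biprojective_net_def
  proof (intro conjI allI ballI)
    show "bounded_clinear (\<sigma> p)" if "p \<in> E" for p
      using net g[OF that] by (auto simp: approx_biprojective_net_def \<sigma>_def good_def)
    show "((\<lambda>p. left_action mul a (\<sigma> p b) - \<sigma> p (mul a b)) \<longlongrightarrow> 0) (tails E sub)" for a b
      by (rule ev[of "{a, b}"]) (use g in \<open>auto simp: \<sigma>_def good_def\<close>)
    show "((\<lambda>p. \<sigma> p (mul b a) - right_action mul (\<sigma> p b) a) \<longlongrightarrow> 0) (tails E sub)" for a b
      by (rule ev[of "{a, b}"]) (use g in \<open>auto simp: \<sigma>_def good_def\<close>)
    show "((\<lambda>p. product_map mul (\<sigma> p a) - a) \<longlongrightarrow> 0) (tails E sub)" for a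
      by (rule ev[of "{a}"]) (use g in \<open>auto simp: \<sigma>_def good_def\<close>)
  qed (rule E)
  then show ?thesis by (auto simp: approximately_biprojective_def)
qed

end

theory Submission
  imports Defs
begin

text \<open>Write \<open>a * b = aeb\<close> for the product of \<open>A\<^sub>e\<close> and let \<open>u\<close> be its unit, so that
  \<open>uea = a = aeu\<close> for all \<open>a\<close>. Thus \<open>ue\<close> is a left and \<open>eu\<close> a right identity of \<open>A\<close>; they
  coincide, \<open>A\<close> is unital, and \<open>e\<close> is invertible with inverse \<open>u\<close>. Consequently the two algebras
  have the same multiplication operators: \<open>a * b = (ae)b\<close> and \<open>ab = (au) * b\<close>, and similarly on
  the right. Only the product maps on the tensor square differ, since \<open>x \<otimes> y\<close> goes to \<open>xy\<close> in
  one case and to \<open>xey\<close> in the other.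

  A factor inserted between the two legs of the tensor repairs this without disturbing the outer
  actions: \<open>x \<otimes> y \<mapsto> x \<otimes> uy\<close> intertwines the product map of \<open>A\<close> with that of \<open>A\<^sub>e\<close>, and
  \<open>x \<otimes> y \<mapsto> x \<otimes> ey\<close> goes the other way. Composing an approximately biprojective net of one
  algebra with the appropriate map gives such a net for the other. The two directions are
  instances of the single transfer lemma \<open>approximately_biprojective_transfer\<close>.\<close>

lemma bounded_clinear_compose:
  assumes "bounded_clinear f" and "bounded_clinear g"
  shows "bounded_clinear (\<lambda>x. f (g x))"
  using bounded_linear_compose[of f g] assms
  by (intro bounded_linear_bounded_clinear)
    (auto simp: bounded_clinear_bounded_linear bounded_clinear_def clinear_def)

definition tensor_map_right ::
    "('b::complex_normed_vector \<Rightarrow> 'c::complex_normed_vector) \<Rightarrow>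
     ('a::complex_normed_vector, 'b) ptensor \<Rightarrow> ('a, 'c) ptensor"
  where "tensor_map_right s = ptensor_lift (\<lambda>x y. x \<otimes>\<^sub>p s y)"

lemma tensor_map_right:
  fixes s :: "'b::complex_normed_vector \<Rightarrow> 'c::complex_normed_vector"
  assumes s: "bounded_clinear s"
  shows "bounded_clinear (tensor_map_right s :: ('a::complex_normed_vector, 'b) ptensor \<Rightarrow> _)"
    and "tensor_map_right s ((x::'a) \<otimes>\<^sub>p y) = x \<otimes>\<^sub>p s y"
proof -
  obtain K where K: "\<And>y. norm (s y) \<le> norm y * K" using s by (auto simp: bounded_clinear_def)
  have "norm (x \<otimes>\<^sub>p s y) \<le> norm x * norm y * K" for x :: 'a and y
    using order_trans[OF norm_ptens_le mult_left_mono[OF K[of y] norm_ge_zero[of x]]]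
    by (simp add: mult.assoc)
  moreover have "clinear (\<lambda>y. x \<otimes>\<^sub>p s y)" for x :: 'a
    using s by (intro clinear_compose[OF clinear_ptens(2)]) (simp add: bounded_clinear_def)
  ultimately have B: "bounded_cbilinear (\<lambda>(x::'a) y. x \<otimes>\<^sub>p s y)"
    unfolding bounded_cbilinear_def using clinear_ptens(1) by blast
  show "bounded_clinear (tensor_map_right s :: ('a, 'b) ptensor \<Rightarrow> _)"
    and "tensor_map_right s ((x::'a) \<otimes>\<^sub>p y) = x \<otimes>\<^sub>p s y"
    unfolding tensor_map_right_def by (rule ptensor_lift[OF B])+
qed

text \<open>The hypotheses on \<open>a'\<close> say that every multiplication operator of \<open>mul'\<close> is one of
  \<open>mul\<close>, so the approximate module map property for \<open>mul\<close> contains the one for \<open>mul'\<close>. Because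
  \<open>s\<close> commutes with right multiplications, \<open>id \<otimes> s\<close> is a bimodule map; by the last hypothesis
  it carries one product map to the other. Hence \<open>(id \<otimes> s) \<circ> \<rho>\<^sub>\<alpha>\<close> is the net for \<open>mul'\<close>.\<close>

lemma approximately_biprojective_transfer:
  fixes mul mul' :: "'a::complex_banach \<Rightarrow> 'a \<Rightarrow> 'a"
  assumes alg: "banach_algebra mul" and alg': "banach_algebra mul'"
    and s: "bounded_clinear s"
    and left: "\<And>a. \<exists>a'. \<forall>b. mul' a b = mul a' b"
    and right: "\<And>a. \<exists>a'. \<forall>b. mul' b a = mul b a'"
    and s_mult: "\<And>x a. s (mul x a) = mul (s x) a"
    and s_product: "\<And>x y. mul' x (s y) = mul x y"
    and bip: "approximately_biprojective mul"
  shows "approximately_biprojective mul'"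
proof -
  interpret A: banach_algebra mul by (rule alg)
  interpret A': banach_algebra mul' by (rule alg')
  obtain D :: "('a set \<times> nat) set" and le \<rho> where net: "approx_biprojective_net mul D le \<rho>"
    using bip by (auto simp: approximately_biprojective_def)
  define T where "T = (tensor_map_right s :: ('a, 'a) ptensor \<Rightarrow> _)"
  have T: "bounded_clinear T" and T_ptens: "\<And>x y. T (x \<otimes>\<^sub>p y) = x \<otimes>\<^sub>p s y"
    unfolding T_def by (rule tensor_map_right[OF s])+
  have T_diff: "T (v - w) = T v - T w" for v w
    using T by (intro clinearD) (simp add: bounded_clinear_def)
  have T_null: "((\<lambda>\<alpha>. T (X \<alpha>)) \<longlongrightarrow> 0) F" if "(X \<longlongrightarrow> 0) F" for X :: "'a set \<times> nat \<Rightarrow> _" and F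
    by (rule bounded_linear.tendsto_zero[OF bounded_clinear_bounded_linear[OF T] that])
  have T_left: "left_action mul' a (T v) = T (left_action mul a' v)"
    if a': "\<And>b. mul' a b = mul a' b" for a a' v
    by (rule fun_cong[OF bounded_clinear_ptensor_eqI])
      (auto intro!: bounded_clinear_compose[OF A'.left_action(1) T]
        bounded_clinear_compose[OF T A.left_action(1)]
        simp: T_ptens A.left_action A'.left_action a')
  have T_right: "right_action mul' (T v) a = T (right_action mul v a')"
    if a': "\<And>b. mul' b a = mul b a'" for a a' v
    by (rule fun_cong[OF bounded_clinear_ptensor_eqI])
      (auto intro!: bounded_clinear_compose[OF A'.right_action(1) T]
        bounded_clinear_compose[OF T A.right_action(1)]
        simp: T_ptens A.right_action A'.right_action a' s_mult)
  have T_product: "product_map mul' (T v) = product_map mul v" for v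
    by (rule fun_cong[OF bounded_clinear_ptensor_eqI])
      (auto intro!: bounded_clinear_compose[OF A'.product_map(1) T] A.product_map(1)
        simp: T_ptens A.product_map A'.product_map s_product)
  have "approx_biprojective_net mul' D le (\<lambda>\<alpha> a. T (\<rho> \<alpha> a))"
    unfolding approx_biprojective_net_def
  proof (intro conjI allI ballI)
    show "directed_set D le" using net by (simp add: approx_biprojective_net_def)
    show "bounded_clinear (\<lambda>a. T (\<rho> \<alpha> a))" if "\<alpha> \<in> D" for \<alpha>
      using net that by (intro bounded_clinear_compose[OF T]) (simp add: approx_biprojective_net_def)
  next
    fix a b
    obtain a' where a': "\<And>b. mul' a b = mul a' b" using left by blast
    have "((\<lambda>\<alpha>. left_action mul a' (\<rho> \<alpha> b) - \<rho> \<alpha> (mul a' b)) \<longlongrightarrow> 0) (tails D le)"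
      using net unfolding approx_biprojective_net_def by blast
    from T_null[OF this]
    show "((\<lambda>\<alpha>. left_action mul' a (T (\<rho> \<alpha> b)) - T (\<rho> \<alpha> (mul' a b))) \<longlongrightarrow> 0) (tails D le)"
      by (simp only: T_left[OF a'] T_diff a')
  next
    fix a b
    obtain a' where a': "\<And>b. mul' b a = mul b a'" using right by blast
    have "((\<lambda>\<alpha>. \<rho> \<alpha> (mul b a') - right_action mul (\<rho> \<alpha> b) a') \<longlongrightarrow> 0) (tails D le)"
      using net unfolding approx_biprojective_net_def by blast
    from T_null[OF this]
    show "((\<lambda>\<alpha>. T (\<rho> \<alpha> (mul' b a)) - right_action mul' (T (\<rho> \<alpha> b)) a) \<longlongrightarrow> 0) (tails D le)"
      by (simp only: T_right[OF a'] T_diff a')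
  next
    fix a
    show "((\<lambda>\<alpha>. product_map mul' (T (\<rho> \<alpha> a)) - a) \<longlongrightarrow> 0) (tails D le)"
      using net by (simp add: T_product approx_biprojective_net_def)
  qed
  then show ?thesis by (rule approximately_biprojectiveI)
qed

lemma (in banach_algebra) bounded_clinear_mult_right: "bounded_clinear (\<lambda>b. mul a b)"
  unfolding bounded_clinear_def
  using clinear_mult_right norm_mult_le by (auto simp: mult.commute intro!: exI[of _ "norm a"])

theorem theorem3p1:
  fixes mul :: "'a::complex_banach \<Rightarrow> 'a \<Rightarrow> 'a" and e :: 'a
  assumes "banach_algebra mul"
    and "norm e \<le> 1"
  shows "(approximately_biprojective mul \<and> unital (twisted_mult mul e) \<longrightarrow>
           approximately_biprojective (twisted_mult mul e)) \<and>
         (unital (twisted_mult mul e) \<and> approximately_biprojective (twisted_mult mul e) \<longrightarrow>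
           approximately_biprojective mul)"
proof -
  interpret A: banach_algebra mul by (rule assms)
  have alg_e: "banach_algebra (twisted_mult mul e)"
    by (rule A.banach_algebra_twisted[OF assms(2)])
  have iff: "approximately_biprojective (twisted_mult mul e) \<longleftrightarrow> approximately_biprojective mul"
    if unit: "unital (twisted_mult mul e)"
  proof -
    obtain u where u: "\<And>a. mul u (mul e a) = a" "\<And>a. mul a (mul e u) = a"
      using unit by (auto simp: unital_def twisted_mult_def A.mul_assoc)
    \<comment> \<open>In \<open>A\<close> the right identity \<open>eu\<close> is also a left identity, because \<open>ue\<close> is one.\<close>
    have eu: "mul e (mul u a) = a" for a
      using u(1)[of "mul e (mul u a)"] u(1)[of "mul u a"] u(1)[of a] u(2)[of "mul u e"]
      by (metis A.mul_assoc u)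
    show ?thesis
    proof
      assume "approximately_biprojective (twisted_mult mul e)"
      then show "approximately_biprojective mul"
      proof (rule approximately_biprojective_transfer
          [OF alg_e assms(1) A.bounded_clinear_mult_right[of e], rotated -1])
        show "\<exists>a'. \<forall>b. mul a b = twisted_mult mul e a' b" for a
          by (intro exI[of _ "mul a u"]) (simp add: twisted_mult_def A.mul_assoc u)
        show "\<exists>a'. \<forall>b. mul b a = twisted_mult mul e b a'" for a
          by (intro exI[of _ "mul u a"]) (simp add: twisted_mult_def A.mul_assoc eu)
      qed (simp_all add: twisted_mult_def A.mul_assoc)
    next
      assume "approximately_biprojective mul"
      then show "approximately_biprojective (twisted_mult mul e)"
      proof (rule approximately_biprojective_transfer
          [OF assms(1) alg_e A.bounded_clinear_mult_right[of u], rotated -1])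
        show "\<exists>a'. \<forall>b. twisted_mult mul e a b = mul a' b" for a
          by (intro exI[of _ "mul a e"]) (simp add: twisted_mult_def)
        show "\<exists>a'. \<forall>b. twisted_mult mul e b a = mul b a'" for a
          by (intro exI[of _ "mul e a"]) (simp add: twisted_mult_def A.mul_assoc)
      qed (simp_all add: twisted_mult_def A.mul_assoc eu)
    qed
  qed
  then show ?thesis by blast
qed

end
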